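(* Let $0<\beta\le1$, fix one of the signs $\pm$, and let $f:\mathbb{R}\to\mathbb{R}$ be a function whose fractional velocity $\upsilon^{\beta}_{\pm}f(x)$ exists finitely at every $x$. Then the set of points of discontinuity of the function $x\mapsto\upsilon^{\beta}_{\pm}f(x)$ is an $F_{\sigma}$ set of the first category.
   Context: For $\epsilon>0$ put $\Delta^{+}_{\epsilon}[f](x)=f(x+\epsilon)-f(x)$ and $\Delta^{-}_{\epsilon}[f](x)=f(x)-f(x-\epsilon)$. The fractional velocity of order $\beta$ is $\upsilon^{\beta}_{\pm}f(x)=\lim_{\epsilon\to0^+}\Delta^{\pm}_{\epsilon}[f](x)/\epsilon^{\beta}$. First category means meager (a countable union of nowhere dense sets). *)

theory Defs
  imports "HOL-Analysis.Analysis"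
begin

datatype direction = Forward | Backward

fun increment :: "direction \<Rightarrow> real \<Rightarrow> (real \<Rightarrow> real) \<Rightarrow> real \<Rightarrow> real" where
  "increment Forward \<epsilon> f x = f (x + \<epsilon>) - f x"
| "increment Backward \<epsilon> f x = f x - f (x - \<epsilon>)"

definition has_frac_velocity ::
    "direction \<Rightarrow> real \<Rightarrow> (real \<Rightarrow> real) \<Rightarrow> real \<Rightarrow> real \<Rightarrow> bool" where
  "has_frac_velocity s \<beta> f x v \<longleftrightarrow>
     ((\<lambda>\<epsilon>. increment s \<epsilon> f x / \<epsilon> powr \<beta>) \<longlongrightarrow> v) (at_right 0)"

(* Total function; meaningful only at points where the limit exists in the reals. *)
definition frac_velocity :: "direction \<Rightarrow> real \<Rightarrow> (real \<Rightarrow> real) \<Rightarrow> real \<Rightarrow> real" where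
  "frac_velocity s \<beta> f x = Lim (at_right 0) (\<lambda>\<epsilon>. increment s \<epsilon> f x / \<epsilon> powr \<beta>)"

lemma frac_velocity_eq: "has_frac_velocity s \<beta> f x v \<Longrightarrow> frac_velocity s \<beta> f x = v"
  unfolding has_frac_velocity_def frac_velocity_def by (intro tendsto_Lim) auto

definition nowhere_dense :: "'a::topological_space set \<Rightarrow> bool" where
  "nowhere_dense S \<longleftrightarrow> interior (closure S) = {}"

definition first_category :: "'a::topological_space set \<Rightarrow> bool" where
  "first_category S \<longleftrightarrow>
     (\<exists>N :: nat \<Rightarrow> 'a set. (\<forall>n. nowhere_dense (N n)) \<and> S = (\<Union>n. N n))"

end

theory Submission
  imports Defs
begin

text \<open>The hypothesis forces \<open>f\<close> to be continuous from one side, hence so are the difference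
  quotients \<open>g\<^sub>n\<close> with increment \<open>1/n\<close>, and the velocity is their pointwise limit. By Baire,
  every open interval contains an interval \<open>J\<close> in which the points with
  \<open>dist (g\<^sub>p x) (g\<^sub>q x) \<le> e\<close> for all \<open>p, q \<ge> N\<close> are dense; one-sided continuity is enough to
  pass from a dense subset to all of \<open>J\<close>, because a one-sided neighbourhood has interior points
  arbitrarily close to its base point. For the same reason \<open>g\<^sub>N\<close> varies little on some subinterval
  of \<open>J\<close>, and then so does the velocity. So for every \<open>e > 0\<close> the closed set where the oscillation
  of the velocity is at least \<open>e\<close> has empty interior.\<close>

text \<open>Baire's theorem in the form used below: the complements of the sets
  \<open>closure (N n)\<close> are open and dense, so their intersection is dense, yet it misses
  \<open>W\<close>.\<close>

lemma open_first_category_empty: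
  fixes W :: "'a::{real_normed_vector,heine_borel} set"
  assumes "open W" "first_category W"
  shows "W = {}"
proof -
  obtain N :: "nat \<Rightarrow> 'a set" where N: "\<And>n. interior (closure (N n)) = {}" "W = (\<Union>n. N n)"
    using assms(2) unfolding first_category_def nowhere_dense_def by blast
  let ?G = "range (\<lambda>n. - closure (N n))"
  have "UNIV \<subseteq> closure (\<Inter>?G)"
    by (rule Baire) (auto simp: closure_complement N(1))
  moreover have "W \<inter> \<Inter>?G = {}"
    unfolding N(2) using closure_subset[of "N _"] by blast
  ultimately show ?thesis
    using open_Int_closure_eq_empty[OF assms(1), of "\<Inter>?G"] by blast
qed

text \<open>The condition \<open>x \<in> closure (interior S)\<close> covers one-sided neighbourhoods in either direction.\<close>

lemma continuous_within_imp_open_subset: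
  assumes "continuous (at x within S) k" "x \<in> closure (interior S)"
    and "open T" "k x \<in> T" "open U" "x \<in> U"
  obtains V where "open V" "V \<noteq> {}" "V \<subseteq> U" "k ` V \<subseteq> T"
proof -
  obtain A where A: "open A" "x \<in> A" "\<forall>y\<in>S. y \<in> A \<longrightarrow> k y \<in> T"
    using assms(1,3,4) unfolding continuous_within_topological by blast
  \<comment> \<open>\<open>k\<close> is controlled only on \<open>S\<close>, hence the passage to
    \<open>interior S\<close>. The set may omit \<open>x\<close>, but it is nonempty because
    \<open>x\<close> is in the closure of \<open>interior S\<close>.\<close>
  let ?V = "A \<inter> U \<inter> interior S"
  show thesis
  proof
    show "open ?V" using A(1) assms(5) by auto
    show "?V \<noteq> {}"
      using assms(2) A(1,2) assms(5,6) open_Int_closure_eq_empty[of "A \<inter> U" "interior S"] by blast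
    show "?V \<subseteq> U" "k ` ?V \<subseteq> T"
      using A(3) interior_subset by blast+
  qed
qed

lemma pointwise_limit_small_oscillation:
  fixes g :: "nat \<Rightarrow> 'a::{real_normed_vector,heine_borel} \<Rightarrow> 'b::metric_space"
  assumes cont: "\<And>n x. continuous (at x within S x) (g n)"
    and S: "\<And>x. x \<in> closure (interior (S x))"
    and lim: "\<And>x. (\<lambda>n. g n x) \<longlonglongrightarrow> h x"
    and "open W" "W \<noteq> {}" "0 < e"
  obtains V where "open V" "V \<noteq> {}" "V \<subseteq> W" "\<And>y z. y \<in> V \<Longrightarrow> z \<in> V \<Longrightarrow> dist (h y) (h z) < e"
proof -
  \<comment> \<open>Going from \<open>h y\<close> to \<open>h z\<close> through
    \<open>g N y\<close>, \<open>g N x\<close> and \<open>g N z\<close> takes four steps of length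
    at most \<open>d\<close>.\<close>
  define d where "d = e / 5"
  have "0 < d" using \<open>0 < e\<close> by (simp add: d_def)
  \<comment> \<open>\<open>E N\<close> need not be closed, since \<open>g n\<close> is continuous at
    \<open>x\<close> only within \<open>S x\<close>. Baire's theorem thus yields density of some
    \<open>E N\<close> in an open set, and \<open>J_sub\<close> has to recover every point of
    \<open>J\<close>.\<close>
  define E where "E N = {x. \<forall>p\<ge>N. \<forall>q\<ge>N. dist (g p x) (g q x) \<le> d}" for N
  have "x \<in> (\<Union>N. E N)" for x
  proof -
    have "Cauchy (\<lambda>n. g n x)"
      using lim LIMSEQ_imp_Cauchy by blast
    then show ?thesis
      using metric_CauchyD[OF _ \<open>0 < d\<close>] unfolding E_def by (fastforce intro: less_imp_le)
  qed
  then have "W = (\<Union>N. E N \<inter> W)" by auto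
  then obtain N where N: "\<not> nowhere_dense (E N \<inter> W)"
    using open_first_category_empty[OF \<open>open W\<close>] \<open>W \<noteq> {}\<close> unfolding first_category_def by metis
  define J where "J = interior (closure (E N \<inter> W)) \<inter> W"
  have "open J" using \<open>open W\<close> by (simp add: J_def open_Int)
  have meets: "V \<inter> E N \<noteq> {}" if "open V" "V \<noteq> {}" "V \<subseteq> interior (closure (E N \<inter> W))" for V
    using that open_Int_closure_eq_empty[OF that(1), of "E N \<inter> W"] interior_subset by blast
  have "J \<noteq> {}"
    using N open_Int_closure_eq_empty[of "interior (closure (E N \<inter> W))" "E N \<inter> W"] interior_subset
    unfolding J_def nowhere_dense_def by fastforce
  have J_sub: "J \<subseteq> E N"
  proof
    fix x assume "x \<in> J"
    show "x \<in> E N"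
    proof (rule ccontr)
      assume "x \<notin> E N"
      then obtain p q where pq: "N \<le> p" "N \<le> q" "d < dist (g p x) (g q x)"
        by (auto simp: E_def not_le)
      \<comment> \<open>A failure of the bound at \<open>x\<close> spreads to a nonempty open subset
        of \<open>J\<close>, which must meet \<open>E N\<close> by density.\<close>
      have "continuous (at x within S x) (\<lambda>y. dist (g p y) (g q y))"
        by (intro continuous_intros cont)
      then obtain V where V: "open V" "V \<noteq> {}" "V \<subseteq> J" "(\<lambda>y. dist (g p y) (g q y)) ` V \<subseteq> {d<..}"
        using continuous_within_imp_open_subset[OF _ S, of x _ "{d<..}" J] pq(3) \<open>open J\<close> \<open>x \<in> J\<close>
        by auto
      then obtain y where "y \<in> V" "y \<in> E N"
        using meets[of V] unfolding J_def by blast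
      then show False
        using V(4) pq(1,2) unfolding E_def by fastforce
    qed
  qed
  \<comment> \<open>Take \<open>p = N\<close> in the definition of \<open>E N\<close> and let
    \<open>q\<close> tend to infinity.\<close>
  have close: "dist (g N y) (h y) \<le> d" if "y \<in> J" for y
  proof (rule tendsto_upperbound)
    show "(\<lambda>n. dist (g N y) (g n y)) \<longlonglongrightarrow> dist (g N y) (h y)"
      by (intro tendsto_intros lim)
    show "\<forall>\<^sub>F n in sequentially. dist (g N y) (g n y) \<le> d"
      using J_sub that unfolding E_def by (intro eventually_sequentiallyI[of N]) auto
  qed simp
  obtain x where "x \<in> J" using \<open>J \<noteq> {}\<close> by blast
  obtain V where V: "open V" "V \<noteq> {}" "V \<subseteq> J" "g N ` V \<subseteq> ball (g N x) d"
    using continuous_within_imp_open_subset[OF cont S open_ball _ \<open>open J\<close> \<open>x \<in> J\<close>] \<open>0 < d\<close>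
    by (metis centre_in_ball)
  show thesis
  proof
    show "open V" "V \<noteq> {}" by fact+
    show "V \<subseteq> W" using V(3) by (auto simp: J_def)
    fix y z assume yz: "y \<in> V" "z \<in> V"
    then have "dist (g N x) (g N y) < d" "dist (g N x) (g N z) < d"
      using V(4) by auto
    moreover have "dist (g N y) (h y) \<le> d" "dist (g N z) (h z) \<le> d"
      using close V(3) yz by auto
    ultimately have "dist (h y) (h z) < 4 * d"
      using dist_triangle[of "h y" "h z" "g N x"] dist_triangle[of "h y" "g N x" "g N y"]
        dist_triangle[of "g N x" "h z" "g N z"] by (simp add: dist_commute)
    then show "dist (h y) (h z) < e"
      using \<open>0 < d\<close> by (simp add: d_def)
  qed
qed

text \<open>Continuity at \<open>x\<close> means that for each \<open>n\<close> some neighbourhood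
  of \<open>x\<close> has values pairwise closer than \<open>1/(n+1)\<close>. The points failing
  this for a fixed \<open>n\<close> form a closed set, and \<open>small\<close> leaves it no
  interior.\<close>

lemma discontinuities_fsigma_first_category:
  fixes h :: "'a::metric_space \<Rightarrow> 'b::metric_space"
  assumes small: "\<And>W e. open W \<Longrightarrow> W \<noteq> {} \<Longrightarrow> 0 < e \<Longrightarrow>
    \<exists>V. open V \<and> V \<noteq> {} \<and> V \<subseteq> W \<and> (\<forall>y\<in>V. \<forall>z\<in>V. dist (h y) (h z) < e)"
  shows "fsigma {x. \<not> isCont h x} \<and> first_category {x. \<not> isCont h x}"
proof -
  define G where "G e = \<Union>{U. open U \<and> (\<forall>y\<in>U. \<forall>z\<in>U. dist (h y) (h z) < e)}" for e
  define D where "D n = - G (inverse (real (Suc n)))" for n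
  have "isCont h x \<longleftrightarrow> (\<forall>n. x \<in> G (inverse (real (Suc n))))" for x
  proof
    assume "isCont h x"
    show "\<forall>n. x \<in> G (inverse (real (Suc n)))"
    proof
      fix n
      let ?B = "ball (h x) (inverse (real (Suc n)) / 2)"
      obtain U where U: "open U" "x \<in> U" "\<forall>y\<in>U. h y \<in> ?B"
        using \<open>isCont h x\<close>[unfolded continuous_at_open, rule_format, of ?B] by auto
      have "dist (h y) (h z) < inverse (real (Suc n))" if "y \<in> U" "z \<in> U" for y z
      proof (rule dist_triangle_half_r)
        show "dist (h x) (h y) < inverse (real (Suc n)) / 2" "dist (h x) (h z) < inverse (real (Suc n)) / 2"
          using U(3) that by auto
      qed
      with U(1,2) show "x \<in> G (inverse (real (Suc n)))"
        unfolding G_def by blast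
    qed
  next
    assume x: "\<forall>n. x \<in> G (inverse (real (Suc n)))"
    show "isCont h x"
      unfolding continuous_at_eps_delta
    proof (intro allI impI)
      fix e :: real assume "0 < e"
      then obtain n where n: "inverse (real (Suc n)) < e"
        using reals_Archimedean by blast
      obtain U where U: "open U" "x \<in> U" "\<forall>y\<in>U. \<forall>z\<in>U. dist (h y) (h z) < inverse (real (Suc n))"
        using x unfolding G_def by blast
      obtain d where d: "0 < d" "\<And>y. dist y x < d \<Longrightarrow> y \<in> U"
        using U(1,2) unfolding open_dist by blast
      have "dist (h y) (h x) < e" if "dist y x < d" for y
        using U(3) d(2)[OF that] U(2) n by (blast intro: less_trans)
      with d(1) show "\<exists>d>0. \<forall>y. dist y x < d \<longrightarrow> dist (h y) (h x) < e"
        by blast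
    qed
  qed
  then have eq: "{x. \<not> isCont h x} = (\<Union>n. D n)"
    unfolding D_def by auto
  have closed: "closed (D n)" for n
    unfolding D_def G_def by (intro closed_Compl open_Union) auto
  have "interior (D n) = {}" for n
  proof (rule ccontr)
    assume "interior (D n) \<noteq> {}"
    then obtain V where "open V" "V \<noteq> {}" "V \<subseteq> interior (D n)"
      "\<forall>y\<in>V. \<forall>z\<in>V. dist (h y) (h z) < inverse (real (Suc n))"
      using small[of "interior (D n)" "inverse (real (Suc n))"] by auto
    then have "V \<subseteq> G (inverse (real (Suc n)))" "V \<subseteq> D n"
      using interior_subset unfolding G_def by blast+
    then show False using \<open>V \<noteq> {}\<close> unfolding D_def by blast
  qed
  then have "nowhere_dense (D n)" for n
    by (simp add: nowhere_dense_def closed)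
  then show ?thesis
    unfolding eq first_category_def using fsigma.intros[of D, OF closed] by blast
qed

text \<open>The side of \<open>x\<close> that \<open>increment s\<close> probes for positive
  \<epsilon>; it lets both directions share one argument.\<close>

fun one_sided :: "direction \<Rightarrow> real \<Rightarrow> real set" where
  "one_sided Forward x = {x..}"
| "one_sided Backward x = {..x}"

lemma in_closure_interior_one_sided: "x \<in> closure (interior (one_sided s x))"
  by (cases s) auto

text \<open>Multiply the convergent quotient by \<open>\<epsilon> powr \<beta>\<close>, which tends
  to 0 as \<beta> is positive; the product is the increment for \<epsilon> > 0.\<close>

lemma has_frac_velocity_increment_tendsto_0:
  assumes "0 < \<beta>" "has_frac_velocity s \<beta> f x v"
  shows "((\<lambda>\<epsilon>. increment s \<epsilon> f x) \<longlongrightarrow> 0) (at_right 0)"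
proof -
  have "((\<lambda>\<epsilon>::real. \<epsilon> powr \<beta>) \<longlongrightarrow> 0) (at_right 0)"
    using assms(1) by (intro tendsto_eq_intros) (auto simp: eventually_at_filter)
  then have "((\<lambda>\<epsilon>. increment s \<epsilon> f x / \<epsilon> powr \<beta> * \<epsilon> powr \<beta>) \<longlongrightarrow> v * 0) (at_right 0)"
    using assms(2) unfolding has_frac_velocity_def by (intro tendsto_mult)
  then show ?thesis
    by (rule Lim_transform_eventually[THEN tendsto_eq_rhs])
      (auto simp: eventually_at_filter)
qed

lemma continuous_one_sided_iff:
  "continuous (at x within one_sided s x) f \<longleftrightarrow> ((\<lambda>\<epsilon>. increment s \<epsilon> f x) \<longlongrightarrow> 0) (at_right 0)"
proof (cases s)
  case Forward
  have "continuous (at x within {x..}) f \<longleftrightarrow> ((\<lambda>\<epsilon>. f (x + \<epsilon>)) \<longlongrightarrow> f x) (at_right 0)"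
    by (simp add: continuous_within at_within_Ici_at_right filterlim_at_right_to_0[of f _ x] add.commute)
  with Forward show ?thesis
    by (simp add: LIM_zero_iff)
next
  case Backward
  \<comment> \<open>Reflection turns the left limit at \<open>x\<close> into a right limit at
    \<open>- x\<close>, which is then shifted to 0.\<close>
  have "continuous (at x within {..x}) f \<longleftrightarrow> ((\<lambda>\<epsilon>. f (x - \<epsilon>)) \<longlongrightarrow> f x) (at_right 0)"
    by (simp add: continuous_within at_within_Iic_at_left filterlim_at_left_to_right
        filterlim_at_right_to_0[of _ _ "- x"])
  moreover have "((\<lambda>\<epsilon>. f x - f (x - \<epsilon>)) \<longlongrightarrow> 0) (at_right 0) \<longleftrightarrow>
      ((\<lambda>\<epsilon>. f (x - \<epsilon>)) \<longlongrightarrow> f x) (at_right 0)"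
    using tendsto_minus_cancel_left[of "\<lambda>\<epsilon>. f (x - \<epsilon>) - f x" 0] LIM_zero_iff by auto
  ultimately show ?thesis
    using Backward by simp
qed

lemma increment_shift: "increment s \<epsilon> (\<lambda>y. f (y + c)) x = increment s \<epsilon> f (x + c)"
  by (cases s) (simp_all add: algebra_simps)

text \<open>Both terms of the increment are translates of \<open>f\<close>, up to sign, and
  translation preserves the side of continuity.\<close>

lemma continuous_one_sided_increment:
  assumes "\<And>x. continuous (at x within one_sided s x) f"
  shows "continuous (at x within one_sided s x) (increment s \<epsilon> f)"
proof -
  have "continuous (at x within one_sided s x) (\<lambda>y. f (y + c))" for c
    using assms by (simp add: continuous_one_sided_iff increment_shift)
  from this[of \<epsilon>] this[of "- \<epsilon>"] assms
  have "continuous (at x within one_sided s x) (\<lambda>y. increment s \<epsilon> f y)"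
    by (cases s) (simp_all add: continuous_diff)
  then show ?thesis by simp
qed

theorem proposition3:
  fixes \<beta> :: real and s :: direction and f :: "real \<Rightarrow> real"
  assumes "0 < \<beta>" and "\<beta> \<le> 1"
    and "\<And>x. \<exists>v. has_frac_velocity s \<beta> f x v"
  shows "fsigma {x. \<not> isCont (frac_velocity s \<beta> f) x} \<and>
         first_category {x. \<not> isCont (frac_velocity s \<beta> f) x}"
proof (rule discontinuities_fsigma_first_category)
  fix W :: "real set" and e :: real
  assume We: "open W" "W \<noteq> {}" "0 < e"
  \<comment> \<open>With \<open>Suc n\<close> every increment is positive, so no divisor vanishes
    and the sequence approaches 0 from the right.\<close>
  let ?\<epsilon> = "\<lambda>n. inverse (real (Suc n))"
  define g where "g n x = increment s (?\<epsilon> n) f x / ?\<epsilon> n powr \<beta>" for n x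
  have "continuous (at x within one_sided s x) f" for x
    using assms(3)[of x] has_frac_velocity_increment_tendsto_0[OF assms(1)]
    by (auto simp: continuous_one_sided_iff)
  then have cont: "continuous (at x within one_sided s x) (g n)" for n x
    unfolding g_def by (intro continuous_intros continuous_one_sided_increment) auto
  have "filterlim ?\<epsilon> (at_right 0) sequentially"
    using LIMSEQ_inverse_real_of_nat by (intro tendsto_imp_filterlim_at_right) auto
  have lim: "(\<lambda>n. g n x) \<longlonglongrightarrow> frac_velocity s \<beta> f x" for x
  proof -
    obtain v where v: "has_frac_velocity s \<beta> f x v"
      using assms(3) by blast
    with \<open>filterlim ?\<epsilon> (at_right 0) sequentially\<close> have "(\<lambda>n. g n x) \<longlonglongrightarrow> v"
      unfolding g_def has_frac_velocity_def by (rule filterlim_compose[rotated])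
    then show ?thesis
      by (simp add: frac_velocity_eq[OF v])
  qed
  obtain V where "open V" "V \<noteq> {}" "V \<subseteq> W"
    "\<And>y z. y \<in> V \<Longrightarrow> z \<in> V \<Longrightarrow> dist (frac_velocity s \<beta> f y) (frac_velocity s \<beta> f z) < e"
    by (rule pointwise_limit_small_oscillation[OF cont in_closure_interior_one_sided lim We]) (rule that)
  then show "\<exists>V. open V \<and> V \<noteq> {} \<and> V \<subseteq> W \<and>
      (\<forall>y\<in>V. \<forall>z\<in>V. dist (frac_velocity s \<beta> f y) (frac_velocity s \<beta> f z) < e)"
    by blast
qed

end
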